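(* Let $K$ be a field with a nontrivial valuation $\operatorname{val}:K^*\to\mathbb R$ whose value group $\Gamma=\operatorname{val}(K^* )\subseteq\mathbb R$ is dense in $\mathbb R$ and contains $\mathbb Q$, and assume that the valuation admits a splitting. Let $I\subseteq K[x_1^{\pm1},\dots,x_n^{\pm1}]$ be an ideal. Then a tropical basis for $I$ exists; that is, there is a finite collection $\{f_1,\dots,f_r\}\subseteq I$ with $I=\langle f_1,\dots,f_r\rangle$ and $$\operatorname{trop}(V(I))=\bigcap_{i=1}^r\operatorname{trop}(V(f_i)).$$
   Context: A splitting of the valuation is a group homomorphism $\Gamma\to K^*$, $w\mapsto t^w$, with $\operatorname{val}(t^w)=w$. For a nonzero Laurent polynomial $f=\sum_{u\in\mathbb Z^n}c_ux^u\in K[x_1^{\pm1},\dots,x_n^{\pm1}]$, let $\operatorname{trop}(f):\mathbb R^n\to\mathbb R$ be $\operatorname{trop}(f)(w)=\min_{u:\,c_u\ne0}(\operatorname{val}(c_u)+w\cdot u)$, and let $\operatorname{trop}(V(f))\subseteq\mathbb R^n$ be its non-linear locus, that is, the set of $w\in\mathbb R^n$ at which the minimum is achieved at least twice; for $f=0$, $\operatorname{trop}(V(f))=\mathbb R^n$. For an ideal $I\subseteq K[x_1^{\pm1},\dots,x_n^{\pm1}]$, $$\operatorname{trop}(V(I))=\bigcap_{f\in I}\operatorname{trop}(V(f))\subseteq\mathbb R^n.$$ *)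

theory Defs
  imports "HOL-Analysis.Analysis" "HOL-Library.Poly_Mapping"
begin

section \<open>Valuations on a field\<close>

text \<open>
  A valuation is a map on \<open>K - {0}\<close>; here it is a total function whose value
  at \<open>0\<close> is unspecified and never used.
\<close>

definition is_valuation :: "('k::field \<Rightarrow> real) \<Rightarrow> bool" where
  "is_valuation val \<longleftrightarrow>
     (\<forall>a b. a \<noteq> 0 \<longrightarrow> b \<noteq> 0 \<longrightarrow> val (a * b) = val a + val b) \<and>
     (\<forall>a b. a \<noteq> 0 \<longrightarrow> b \<noteq> 0 \<longrightarrow> a + b \<noteq> 0 \<longrightarrow> min (val a) (val b) \<le> val (a + b))"

definition nontrivial_valuation :: "('k::field \<Rightarrow> real) \<Rightarrow> bool" where
  "nontrivial_valuation val \<longleftrightarrow> is_valuation val \<and> (\<exists>a. a \<noteq> 0 \<and> val a \<noteq> 0)"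

definition value_group :: "('k::field \<Rightarrow> real) \<Rightarrow> real set" where
  "value_group val = val ` (UNIV - {0})"

text \<open>The values of a splitting \<open>t\<close> outside the value group are irrelevant.\<close>

definition is_splitting :: "('k::field \<Rightarrow> real) \<Rightarrow> (real \<Rightarrow> 'k) \<Rightarrow> bool" where
  "is_splitting val t \<longleftrightarrow>
     (\<forall>w\<in>value_group val. t w \<noteq> 0 \<and> val (t w) = w) \<and>
     (\<forall>v\<in>value_group val. \<forall>w\<in>value_group val. t (v + w) = t v * t w)"

section \<open>Laurent polynomials and their ideals\<close>

text \<open>
  The Laurent polynomial ring in variables indexed by \<open>'n\<close> is the group ring
  of \<open>int ^ 'n\<close>: the coefficient of \<open>x\<^sup>u\<close> in \<open>f\<close> is \<open>Poly_Mapping.lookup f u\<close>,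
  the support of \<open>f\<close> is \<open>Poly_Mapping.keys f\<close>, and multiplication is convolution.
\<close>

type_synonym ('k, 'n) laurent = "(int ^ 'n) \<Rightarrow>\<^sub>0 'k"

text \<open>
  Ideals are the submodules of a commutative ring regarded as a module over itself,
  so \<open>ring_module.span S\<close> is the ideal generated by \<open>S\<close>.
\<close>

interpretation ring_module: module "(*) :: 'a::comm_ring_1 \<Rightarrow> 'a \<Rightarrow> 'a"
  by unfold_locales (simp_all add: algebra_simps)

abbreviation is_ideal :: "'a::comm_ring_1 set \<Rightarrow> bool" where
  "is_ideal \<equiv> ring_module.subspace"

abbreviation ideal_generated_by :: "'a::comm_ring_1 set \<Rightarrow> 'a set" where
  "ideal_generated_by \<equiv> ring_module.span"

section \<open>Tropicalization\<close>

definition trop_term ::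
    "('k::field \<Rightarrow> real) \<Rightarrow> ('k, 'n::finite) laurent \<Rightarrow> real ^ 'n \<Rightarrow> int ^ 'n \<Rightarrow> real" where
  "trop_term val f w u = val (Poly_Mapping.lookup f u) + w \<bullet> (\<chi> i. of_int (u $ i))"

text \<open>Only meaningful for \<open>f \<noteq> 0\<close>.\<close>

definition trop ::
    "('k::field \<Rightarrow> real) \<Rightarrow> ('k, 'n::finite) laurent \<Rightarrow> real ^ 'n \<Rightarrow> real" where
  "trop val f w = Min (trop_term val f w ` Poly_Mapping.keys f)"

definition trop_hypersurface ::
    "('k::field \<Rightarrow> real) \<Rightarrow> ('k, 'n::finite) laurent \<Rightarrow> (real ^ 'n) set" where
  "trop_hypersurface val f =
     (if f = 0 then UNIV
      else {w. 2 \<le> card {u \<in> Poly_Mapping.keys f. trop_term val f w u = trop val f w}})"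

definition trop_variety ::
    "('k::field \<Rightarrow> real) \<Rightarrow> ('k, 'n::finite) laurent set \<Rightarrow> (real ^ 'n) set" where
  "trop_variety val I = (\<Inter>f\<in>I. trop_hypersurface val f)"

definition is_tropical_basis ::
    "('k::field \<Rightarrow> real) \<Rightarrow> ('k, 'n::finite) laurent set \<Rightarrow> ('k, 'n) laurent set \<Rightarrow> bool" where
  "is_tropical_basis val I F \<longleftrightarrow>
     finite F \<and> F \<subseteq> I \<and> I = ideal_generated_by F \<and>
     trop_variety val I = (\<Inter>f\<in>F. trop_hypersurface val f)"

end

theory Submission
  imports Defs "HOL-Library.Fun_Lexorder"
begin

text \<open>
  Let \<open>J\<^sub>d\<close> be the space of \<open>f \<in> I\<close> with exponents in the \<open>d\<close>-th dilate of the standard simplex.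
  For a weight \<open>w\<close>, order the terms of a polynomial by \<open>val c + w \<bullet> u\<close>, breaking ties
  lexicographically, and let \<open>M w\<close> be the set of pairs \<open>(d, u)\<close> such that \<open>u\<close> leads an element of
  \<open>J\<^sub>d\<close>. Since each \<open>J\<^sub>d\<close> is finite dimensional, every \<open>(d, u) \<in> M w\<close> is led by a reduced element
  \<open>r (d, u)\<close>, which has no other exponent in \<open>M w\<close> and depends on \<open>w\<close> only through \<open>M w\<close>.
  The sets \<open>M w\<close> are up-sets, and no degree-\<open>d\<close> part is properly contained in another one, so by
  Dickson's lemma only finitely many of them occur. For fixed \<open>M w\<close>, the exponents at which the
  finitely many generators \<open>r m\<close> of \<open>M w\<close> attain their minimum determine those of every \<open>r (d, u)\<close>.
  If some \<open>f \<in> J\<^sub>d\<close> attains its minimum at \<open>w\<close> only at \<open>u\<close>, then so does \<open>r (d, u)\<close>, and hence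
  one such reduced element serves all weights with the same \<open>M w\<close> and the same ties; there are
  finitely many such classes.
\<close>

abbreviation coef :: "('a \<Rightarrow>\<^sub>0 'b::zero) \<Rightarrow> 'a \<Rightarrow> 'b" where
  "coef \<equiv> Poly_Mapping.lookup"

abbreviation supp :: "('a \<Rightarrow>\<^sub>0 'b::zero) \<Rightarrow> 'a set" where
  "supp \<equiv> Poly_Mapping.keys"

section \<open>Monomial multiples\<close>

lemma coef_monomial_mult:
  fixes f :: "'a::ab_group_add \<Rightarrow>\<^sub>0 'b::comm_ring_1"
  shows "coef (Poly_Mapping.single a c * f) v = c * coef f (v - a)"
proof -
  have "coef f (v - a) = (Sum_any (\<lambda>q. coef f q when v = a + q))"
  proof -
    have "(Sum_any (\<lambda>q. coef f q when v = a + q)) = (Sum_any (\<lambda>q. coef f q when q = v - a))"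
      by (rule Sum_any.cong) (simp add: when_def algebra_simps)
    then show ?thesis by simp
  qed
  moreover have "coef (Poly_Mapping.single a c * f) v
      = (Sum_any (\<lambda>l. c * (Sum_any (\<lambda>q. coef f q when v = l + q)) when l = a))"
    unfolding lookup_mult lookup_single
    by (rule Sum_any.cong) (simp add: when_def)
  ultimately show ?thesis by simp
qed

lemma supp_monomial_mult:
  fixes f :: "'a::ab_group_add \<Rightarrow>\<^sub>0 'b::field"
  assumes "c \<noteq> 0"
  shows "v \<in> supp (Poly_Mapping.single a c * f) \<longleftrightarrow> v - a \<in> supp f"
  using assms by (simp add: in_keys_iff coef_monomial_mult)

lemma monomial_mult_cancel:
  fixes f :: "'a::ab_group_add \<Rightarrow>\<^sub>0 'b::field"
  assumes "c \<noteq> 0"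
  shows "Poly_Mapping.single (- a) (inverse c) * (Poly_Mapping.single a c * f) = f"
  by (rule poly_mapping_eqI) (simp only: coef_monomial_mult, simp add: assms)

section \<open>Dickson's lemma\<close>

text \<open>Every sequence has a monotone subsequence; a decreasing one of natural numbers is
  constant once it reaches its minimum, so its tail is increasing as well.\<close>

lemma monotone_subsequence_nat:
  fixes s :: "nat \<Rightarrow> nat"
  obtains r :: "nat \<Rightarrow> nat" where "strict_mono r" "incseq (s \<circ> r)"
proof -
  obtain r where r: "strict_mono r" "monoseq (\<lambda>n. s (r n))"
    using seq_monosub[of s] by blast
  show ?thesis
  proof (cases "incseq (\<lambda>n. s (r n))")
    case True
    then show ?thesis using that[of r] r by (simp add: comp_def)
  next
    case False
    then have dec: "decseq (\<lambda>n. s (r n))" using r(2) by (simp add: monoseq_iff)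
    define k where "k = arg_min (\<lambda>n. s (r n)) (\<lambda>_. True)"
    have k: "s (r k) \<le> s (r n)" for n
      unfolding k_def by (rule arg_min_nat_le) simp
    have const: "s (r (k + n)) = s (r k)" for n
      using k[of "k + n"] decseqD[OF dec, of k "k + n"] by simp
    have "strict_mono (\<lambda>n. r (k + n))"
      using r(1) by (simp add: strict_mono_def)
    moreover have "incseq (s \<circ> (\<lambda>n. r (k + n)))"
      by (rule monoI) (simp add: const)
    ultimately show ?thesis by (rule that)
  qed
qed

lemma dickson_subsequence:
  fixes s :: "nat \<Rightarrow> 'i \<Rightarrow> nat"
  assumes "finite S"
  shows "\<exists>r::nat \<Rightarrow> nat. strict_mono r \<and> (\<forall>i\<in>S. incseq (\<lambda>n. s (r n) i))"
  using assms
proof (induction S rule: finite_induct)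
  case empty
  show ?case by (auto intro: exI[of _ id] simp: strict_mono_def)
next
  case (insert i S)
  then obtain r where r: "strict_mono r" "\<forall>j\<in>S. incseq (\<lambda>n. s (r n) j)" by blast
  obtain q where q: "strict_mono q" "incseq ((\<lambda>n. s (r n) i) \<circ> q)"
    by (rule monotone_subsequence_nat)
  have "incseq (\<lambda>n. s (r (q n)) j)" if "j \<in> S" for j
    using r(2) that strict_mono_mono[OF q(1)] by (auto simp: mono_def)
  then show ?case
    using q r(1) by (intro exI[of _ "r \<circ> q"]) (auto simp: comp_def strict_mono_def)
qed

text \<open>Otherwise every finite \<open>B\<close> with \<open>P B\<close> could be enlarged by
  some \<open>m\<close> above none of its elements; iterating gives a sequence that violates
  \<open>wqo\<close>. This serves both to generate an up-set finitely and to bound the number of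
  up-sets.\<close>

lemma exists_maximal_finite_property:
  assumes wqo: "\<And>s. (\<And>n::nat. s n \<in> N) \<Longrightarrow> \<exists>i j. i < j \<and> le (s i) (s j)"
    and "P {}"
  shows "\<exists>B. finite B \<and> B \<subseteq> N \<and> P B \<and> (\<forall>m\<in>N. P (insert m B) \<longrightarrow> (\<exists>b\<in>B. le b m))"
proof (rule ccontr)
  assume contr: "\<not> ?thesis"
  define Q where "Q B \<longleftrightarrow> finite B \<and> B \<subseteq> N \<and> P B" for B
  define R where "R B C \<longleftrightarrow> (\<exists>m\<in>N. (\<forall>b\<in>B. \<not> le b m) \<and> C = insert m B)" for B C
  have "\<exists>B. \<forall>n::nat. Q (B n) \<and> R (B n) (B (Suc n))"
  proof (rule dependent_nat_choice)
    show "\<exists>B. Q B" using assms(2) by (auto simp: Q_def)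
    fix B and n :: nat
    assume B: "Q B"
    with contr obtain m where "m \<in> N" "P (insert m B)" "\<forall>b\<in>B. \<not> le b m"
      by (auto simp: Q_def)
    with B show "\<exists>C. Q C \<and> R B C"
      by (intro exI[of _ "insert m B"]) (auto simp: Q_def R_def)
  qed
  then obtain B where B: "\<And>n::nat. R (B n) (B (Suc n))" by auto
  have "\<forall>n. \<exists>m. m \<in> N \<and> (\<forall>b\<in>B n. \<not> le b m) \<and> B (Suc n) = insert m (B n)"
    using B unfolding R_def Bex_def by (rule allI)
  from choice[OF this] obtain s where s: "\<And>n. s n \<in> N" "\<And>n. \<forall>b\<in>B n. \<not> le b (s n)"
      "\<And>n. B (Suc n) = insert (s n) (B n)"
    by auto
  have "incseq B" by (rule incseq_SucI) (auto simp: s(3))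
  then have "s i \<in> B j" if "i < j" for i j
    using incseqD[of B "Suc i" j] that s(3)[of i] by auto
  moreover obtain i j where "i < j" "le (s i) (s j)" using wqo[of s, OF s(1)] by blast
  ultimately show False using s(2) by auto
qed

section \<open>Simplices of exponents\<close>

definition simplex_points :: "nat \<Rightarrow> (int ^ 'n::finite) set" where
  "simplex_points d = {u. (\<forall>i. 0 \<le> u $ i) \<and> (\<Sum>i\<in>UNIV. u $ i) \<le> int d}"

text \<open>The pair \<open>(d, u)\<close> stands for a monomial of degree \<open>d\<close> in one
  more variable, the extra exponent being \<open>d\<close> minus the coordinate sum of
  \<open>u\<close>. On \<open>graded_exponents\<close> this order is divisibility.\<close>

definition graded_le :: "nat \<times> (int ^ 'n::finite) \<Rightarrow> nat \<times> (int ^ 'n) \<Rightarrow> bool" where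
  "graded_le m m' \<longleftrightarrow> fst m \<le> fst m' \<and> snd m' - snd m \<in> simplex_points (fst m' - fst m)"

definition graded_exponents :: "(nat \<times> (int ^ 'n::finite)) set" where
  "graded_exponents = {(d, u). u \<in> simplex_points d}"

lemma simplex_points_add: "u \<in> simplex_points d \<Longrightarrow> v \<in> simplex_points e \<Longrightarrow> u + v \<in> simplex_points (d + e)"
  by (auto simp: simplex_points_def sum.distrib)

lemma simplex_points_coordinate_le:
  assumes "u \<in> simplex_points d"
  shows "u $ i \<le> int d"
proof -
  have "u $ i \<le> (\<Sum>i\<in>UNIV. u $ i)"
    using assms by (intro member_le_sum) (auto simp: simplex_points_def)
  then show ?thesis using assms by (auto simp: simplex_points_def)
qed

lemma finite_simplex_points: "finite (simplex_points d :: (int ^ 'n::finite) set)"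
proof (rule finite_subset)
  show "simplex_points d \<subseteq> (\<lambda>f. \<chi> i::'n. f i) ` (UNIV \<rightarrow>\<^sub>E {0..int d})"
  proof
    fix u :: "int ^ 'n"
    assume u: "u \<in> simplex_points d"
    then have "(\<lambda>i. u $ i) \<in> UNIV \<rightarrow>\<^sub>E {0..int d}"
      using simplex_points_coordinate_le[OF u] by (auto simp: simplex_points_def)
    then show "u \<in> (\<lambda>f. \<chi> i::'n. f i) ` (UNIV \<rightarrow>\<^sub>E {0..int d})"
      by (rule rev_image_eqI) (simp add: vec_eq_iff)
  qed
  show "finite ((\<lambda>f. \<chi> i::'n. f i) ` (UNIV \<rightarrow>\<^sub>E {0..int d}))"
    by (intro finite_imageI finite_PiE) auto
qed

text \<open>Monomials are units, so this replaces a Laurent polynomial by a polynomial of bounded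
  degree that generates the same ideal.\<close>

lemma finite_translate_into_simplex_points:
  fixes S :: "(int ^ 'n::finite) set"
  assumes "finite S"
  obtains a d where "\<And>u. u \<in> S \<Longrightarrow> a + u \<in> simplex_points d"
proof -
  define c where "c = (\<Sum>u\<in>S. \<Sum>i\<in>UNIV. \<bar>u $ i\<bar>)"
  have c: "\<bar>u $ i\<bar> \<le> c" if "u \<in> S" for u i
  proof -
    have "\<bar>u $ i\<bar> \<le> (\<Sum>i\<in>UNIV. \<bar>u $ i\<bar>)" by (intro member_le_sum) auto
    also have "\<dots> \<le> c" unfolding c_def using assms that
      by (intro member_le_sum) (auto intro: sum_nonneg)
    finally show ?thesis .
  qed
  define d where "d = nat (\<Sum>i\<in>(UNIV::'n set). 2 * c)"
  have "(\<chi> i. c) + u \<in> simplex_points d" if "u \<in> S" for u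
  proof -
    have "(\<Sum>i\<in>UNIV. c + u $ i) \<le> (\<Sum>i\<in>(UNIV::'n set). 2 * c)"
    proof (rule sum_mono)
      show "c + u $ i \<le> 2 * c" for i using c[OF that, of i] by linarith
    qed
    also have "\<dots> \<le> int d" unfolding d_def by (rule nat_le_iff[THEN iffD1, OF order_refl])
    finally have "(\<Sum>i\<in>UNIV. c + u $ i) \<le> int d" .
    moreover have "0 \<le> c + u $ i" for i using c[OF that, of i] by linarith
    ultimately show ?thesis by (simp add: simplex_points_def)
  qed
  then show ?thesis by (rule that)
qed

lemma graded_le_wqo:
  fixes s :: "nat \<Rightarrow> nat \<times> (int ^ 'n::finite)"
  assumes s: "\<And>n. s n \<in> graded_exponents"
  shows "\<exists>i j. i < j \<and> graded_le (s i) (s j)"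
proof -
  \<comment> \<open>The index \<open>None\<close> carries the exponent of the extra, homogenising
    variable.\<close>
  define x where "x n = (\<lambda>i. case i of Some i \<Rightarrow> nat (snd (s n) $ i)
      | None \<Rightarrow> nat (int (fst (s n)) - (\<Sum>i\<in>UNIV. snd (s n) $ i)))" for n
  obtain r where r: "strict_mono r" "\<And>i. incseq (\<lambda>n. x (r n) i)"
    using dickson_subsequence[of "UNIV :: 'n option set" x] by auto
  define p q where "p = s (r 0)" and "q = s (r 1)"
  have nn: "0 \<le> snd (s n) $ i" "(\<Sum>i\<in>UNIV. snd (s n) $ i) \<le> int (fst (s n))" for n i
    using s[of n] by (auto simp: graded_exponents_def simplex_points_def split: prod.splits)
  have "x (r 0) i \<le> x (r 1) i" for i using monoD[OF r(2)] by simp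
  from this[of None] this[of "Some i" for i]
  have 1: "snd p $ i \<le> snd q $ i" 
    and 2: "int (fst p) - (\<Sum>i\<in>UNIV. snd p $ i) \<le> int (fst q) - (\<Sum>i\<in>UNIV. snd q $ i)" for i
    using nn by (auto simp: x_def p_def q_def nat_le_eq_zle)
  have 3: "(\<Sum>i\<in>UNIV. snd p $ i) \<le> (\<Sum>i\<in>UNIV. snd q $ i)" using 1 by (rule sum_mono)
  have "graded_le p q"
    using 1 2 3 by (auto simp: graded_le_def simplex_points_def sum_subtractf)
  moreover have "r 0 < r 1" using r(1) by (simp add: strict_mono_def)
  ultimately show ?thesis unfolding p_def q_def by blast
qed

section \<open>A translation invariant order on exponents\<close>

text \<open>The function \<open>from_nat\<close> lists every index; repetitions do not affect the
  first place of difference.\<close>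

definition lex_less :: "int ^ 'n::finite \<Rightarrow> int ^ 'n \<Rightarrow> bool" where
  "lex_less u v \<longleftrightarrow> less_fun (\<lambda>k::nat. u $ from_nat k) (\<lambda>k. v $ from_nat k)"

lemma lex_less_irrefl [simp]: "\<not> lex_less u u"
  by (simp add: lex_less_def less_fun_def)

lemma lex_less_trans: "lex_less u v \<Longrightarrow> lex_less v w \<Longrightarrow> lex_less u w"
  unfolding lex_less_def by (rule less_fun_trans)

lemma lex_less_total:
  assumes "u \<noteq> v"
  shows "lex_less u v \<or> lex_less v u"
proof -
  obtain i where "u $ i \<noteq> v $ i" using assms by (auto simp: vec_eq_iff)
  then have ex: "\<exists>k::nat. u $ from_nat k \<noteq> v $ from_nat k"
    by (intro exI[of _ "to_nat i"]) simp
  define k :: nat where "k = (LEAST k. u $ from_nat k \<noteq> v $ from_nat k)"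
  have "u $ from_nat k \<noteq> v $ from_nat k"
    using LeastI_ex[OF ex] by (simp add: k_def)
  moreover have "u $ from_nat j = v $ from_nat j" if "j < k" for j
    using not_less_Least[of j] that by (auto simp: k_def)
  ultimately show ?thesis
    unfolding lex_less_def less_fun_def by (metis linorder_neqE)
qed

lemma lex_less_add_left [simp]: "lex_less (a + u) (a + v) \<longleftrightarrow> lex_less u v"
  by (simp add: lex_less_def less_fun_def)

text \<open>The induction descends from the largest elements; it is well-founded because the number
  of larger elements of the finite set \<open>S\<close> drops.\<close>

lemma lex_less_induct [consumes 2]:
  assumes "finite S" "u \<in> S"
    and step: "\<And>u. u \<in> S \<Longrightarrow> (\<And>v. v \<in> S \<Longrightarrow> lex_less u v \<Longrightarrow> P v) \<Longrightarrow> P u"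
  shows "P u"
proof -
  have "u \<in> S \<longrightarrow> P u"
  proof (induction "card {v \<in> S. lex_less u v}" arbitrary: u rule: less_induct)
    case less
    have "P v" if u: "u \<in> S" and v: "v \<in> S" "lex_less u v" for v
    proof -
      have "{x \<in> S. lex_less v x} \<subset> {x \<in> S. lex_less u x}"
        using v lex_less_trans by fastforce
      then have "card {x \<in> S. lex_less v x} < card {x \<in> S. lex_less u x}"
        using assms(1) by (intro psubset_card_mono) auto
      with less v show ?thesis by blast
    qed
    then show ?case using step by blast
  qed
  then show ?thesis using assms(2) by blast
qed

section \<open>Leading exponents\<close>

abbreviation scal :: "'k::field \<Rightarrow> ('a::ab_group_add \<Rightarrow>\<^sub>0 'k) \<Rightarrow> ('a \<Rightarrow>\<^sub>0 'k)" where
  "scal c f \<equiv> Poly_Mapping.single 0 c * f"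

interpretation coef_space: vector_space "scal :: 'k::field \<Rightarrow> ('a::ab_group_add \<Rightarrow>\<^sub>0 'k) \<Rightarrow> _"
proof
  show "scal a (scal b x) = scal (a * b) x" for a b :: 'k and x :: "'a \<Rightarrow>\<^sub>0 'k"
    unfolding mult.assoc[symmetric] mult_single by simp
qed (simp_all add: algebra_simps single_add)

lemma coef_scal: "coef (scal c f) v = c * coef f v"
  by (simp add: coef_monomial_mult)

lemma coef_sum_scal_delta:
  assumes "finite S" "q \<in> S" "\<And>p. p \<in> S \<Longrightarrow> coef (F p) q = (if p = q then 1 else 0)"
  shows "coef (\<Sum>p\<in>S. scal (c p) (F p)) q = c q"
proof -
  have "coef (\<Sum>p\<in>S. scal (c p) (F p)) q = (\<Sum>p\<in>S. if p = q then c p else 0)"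
    unfolding lookup_sum coef_scal using assms(3) by (intro sum.cong) auto
  then show ?thesis using assms(1,2) by simp
qed

definition term_less :: "real \<times> (int ^ 'n::finite) \<Rightarrow> real \<times> (int ^ 'n) \<Rightarrow> bool" where
  "term_less p q \<longleftrightarrow> fst p < fst q \<or> fst p = fst q \<and> lex_less (snd p) (snd q)"

lemma term_less_trans: "term_less p q \<Longrightarrow> term_less q r \<Longrightarrow> term_less p r"
  by (auto simp: term_less_def intro: lex_less_trans)

lemma finite_term_less_minimum:
  assumes "finite S" "S \<noteq> {}"
  shows "\<exists>u\<in>S. \<forall>v\<in>S. v \<noteq> u \<longrightarrow> term_less (k u, u) (k v, v)"
  using assms
proof (induction S rule: finite_ne_induct)
  case (insert x S)
  then obtain u where u: "u \<in> S" "\<forall>v\<in>S. v \<noteq> u \<longrightarrow> term_less (k u, u) (k v, v)" by blast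
  have "x \<noteq> u" using insert u by auto
  then have "term_less (k u, u) (k x, x) \<or> term_less (k x, x) (k u, u)"
    using lex_less_total[of x u] by (cases "k u" "k x" rule: linorder_cases) (auto simp: term_less_def)
  then consider "term_less (k u, u) (k x, x)" | "term_less (k x, x) (k u, u)" by blast
  then show ?case
  proof cases
    case 1
    then show ?thesis using u by (intro bexI[of _ u]) auto
  next
    case 2
    then have "term_less (k x, x) (k v, v)" if "v \<in> S" for v
      using u that term_less_trans by (cases "v = u") blast+
    then show ?thesis by auto
  qed
qed auto

section \<open>Ultrametric estimates and leading terms over a valued field\<close>

locale valued_field =
  fixes val :: "'k::field \<Rightarrow> real"
  assumes valuation: "is_valuation val"
begin

lemma val_mult: "a \<noteq> 0 \<Longrightarrow> b \<noteq> 0 \<Longrightarrow> val (a * b) = val a + val b"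
  using valuation by (simp add: is_valuation_def)

lemma val_add: "a \<noteq> 0 \<Longrightarrow> b \<noteq> 0 \<Longrightarrow> a + b \<noteq> 0 \<Longrightarrow> min (val a) (val b) \<le> val (a + b)"
  using valuation by (simp add: is_valuation_def)

lemma val_one [simp]: "val 1 = 0"
  using val_mult[of 1 1] by simp

lemma val_uminus [simp]: "val (- a) = val a"
proof (cases "a = 0")
  case False
  have "val (- 1) + val (- 1) = 0" using val_mult[of "- 1" "- 1"] by simp
  then show ?thesis using val_mult[of "- 1" a] False by simp
qed simp

text \<open>This encodes the convention that \<open>0\<close> has infinite value, as
  \<open>val 0\<close> is unspecified.\<close>

definition val_gt :: "real \<Rightarrow> 'k \<Rightarrow> bool" where
  "val_gt r a \<longleftrightarrow> a = 0 \<or> r < val a"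

lemma val_gt_add: "val_gt r a \<Longrightarrow> val_gt r b \<Longrightarrow> val_gt r (a + b)"
  using val_add[of a b] by (cases "a = 0 \<or> b = 0 \<or> a + b = 0") (auto simp: val_gt_def)

lemma val_gt_sum: "(\<And>i. i \<in> S \<Longrightarrow> val_gt r (a i)) \<Longrightarrow> val_gt r (sum a S)"
  by (induction S rule: infinite_finite_induct) (auto intro: val_gt_add simp: val_gt_def[of r 0])

lemma val_add_eq:
  assumes "a \<noteq> 0" "val_gt (val a) b"
  shows "a + b \<noteq> 0 \<and> val (a + b) = val a"
proof (cases "b = 0")
  case False
  then have less: "val a < val b" using assms by (simp add: val_gt_def)
  have nz: "a + b \<noteq> 0"
  proof
    assume "a + b = 0"
    then have "b = - a" by (simp add: add_eq_0_iff)
    with less show False by simp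
  qed
  moreover have "val a \<le> val (a + b)" using val_add[OF assms(1) False nz] less by simp
  \<comment> \<open>Here \<open>a\<close> is recovered as \<open>(a + b) + (- b)\<close>, which
    bounds \<open>val (a + b)\<close> from above.\<close>
  moreover have "min (val (a + b)) (val b) \<le> val a"
    using val_add[of "a + b" "- b"] nz False assms(1) by simp
  ultimately show ?thesis using less by linarith
qed (use assms in simp)

abbreviation tval :: "('k, 'n::finite) laurent \<Rightarrow> real ^ 'n \<Rightarrow> int ^ 'n \<Rightarrow> real" where
  "tval \<equiv> trop_term val"

lemma tval_monomial_mult:
  assumes "c \<noteq> 0" "u \<in> supp f"
  shows "tval (Poly_Mapping.single a c * f) w (a + u)
      = val c + w \<bullet> (\<chi> i. of_int (a $ i)) + tval f w u"
proof -
  have "(\<chi> i. of_int ((a + u) $ i)) = (\<chi> i. of_int (a $ i)) + (\<chi> i. real_of_int (u $ i))"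
    by (simp add: vec_eq_iff)
  then show ?thesis
    using assms val_mult[of c "coef f u"]
    by (simp add: trop_term_def coef_monomial_mult inner_add_right in_keys_iff)
qed

lemma tval_scal: "c \<noteq> 0 \<Longrightarrow> u \<in> supp f \<Longrightarrow> tval (scal c f) w u = val c + tval f w u"
  using tval_monomial_mult[of c u f 0 w] by (simp add: zero_vec_def[symmetric])

definition above :: "real ^ 'n::finite \<Rightarrow> real \<times> (int ^ 'n) \<Rightarrow> ('k, 'n) laurent \<Rightarrow> bool" where
  "above w p f \<longleftrightarrow> (\<forall>v\<in>supp f. term_less p (tval f w v, v))"

definition lead :: "real ^ 'n::finite \<Rightarrow> ('k, 'n) laurent \<Rightarrow> int ^ 'n \<Rightarrow> bool" where
  "lead w f u \<longleftrightarrow> u \<in> supp f \<and>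
     (\<forall>v\<in>supp f. v \<noteq> u \<longrightarrow> term_less (tval f w u, u) (tval f w v, v))"

lemma leadD:
  assumes "lead w f u" "v \<in> supp f"
  shows "tval f w u \<le> tval f w v" "tval f w u = tval f w v \<Longrightarrow> v \<noteq> u \<Longrightarrow> lex_less u v"
  using assms by (auto simp: lead_def term_less_def)

lemma lead_exists: "f \<noteq> 0 \<Longrightarrow> \<exists>u. lead w f u"
  using finite_term_less_minimum[of "supp f" "tval f w"] by (auto simp: lead_def)

lemma above_zero [simp]: "above w p 0"
  by (simp add: above_def)

text \<open>Where both summands have a term at \<open>v\<close>, the exponent is the same, so the
  tie-break is unaffected and the ultrametric inequality suffices.\<close>

lemma term_less_add:
  assumes f: "v \<in> supp f \<Longrightarrow> term_less p (tval f w v, v)"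
    and g: "v \<in> supp g \<Longrightarrow> term_less p (tval g w v, v)"
    and v: "v \<in> supp (f + g)"
  shows "term_less p (tval (f + g) w v, v)"
proof -
  consider "v \<notin> supp f" "v \<in> supp g" | "v \<in> supp f" "v \<notin> supp g" | "v \<in> supp f" "v \<in> supp g"
    using v keys_add[of f g] by blast
  then show ?thesis
  proof cases
    case 3
    then have "min (tval f w v) (tval g w v) \<le> tval (f + g) w v"
      using val_add[of "coef f v" "coef g v"] v
      by (auto simp: trop_term_def in_keys_iff lookup_add)
    then show ?thesis using f g 3 by (auto simp: term_less_def min_def split: if_splits)
  qed (use f g in \<open>simp_all add: trop_term_def in_keys_iff lookup_add\<close>)
qed

lemma above_add: "above w p f \<Longrightarrow> above w p g \<Longrightarrow> above w p (f + g)"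
  unfolding above_def using term_less_add by blast

lemma above_sum: "(\<And>i. i \<in> S \<Longrightarrow> above w p (f i)) \<Longrightarrow> above w p (sum f S)"
  by (induction S rule: infinite_finite_induct) (auto intro: above_add)

lemma lead_add:
  assumes f: "lead w f u" and g: "above w (tval f w u, u) g"
  shows "lead w (f + g) u"
proof -
  have u: "coef f u \<noteq> 0" using f by (simp add: lead_def in_keys_iff)
  \<comment> \<open>A term of \<open>g\<close> at the same exponent \<open>u\<close> cannot come
    later by the tie-break, so its value is strictly larger.\<close>
  have "val_gt (val (coef f u)) (coef g u)"
  proof (cases "coef g u = 0")
    case False
    then have "term_less (tval f w u, u) (tval g w u, u)"
      using g by (simp add: above_def in_keys_iff)
    then show ?thesis by (simp add: val_gt_def term_less_def trop_term_def)
  qed (simp add: val_gt_def)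
  from val_add_eq[OF u this] have sum: "coef (f + g) u \<noteq> 0" "tval (f + g) w u = tval f w u"
    by (auto simp: lookup_add trop_term_def)
  have "term_less (tval f w u, u) (tval (f + g) w v, v)"
    if "v \<in> supp (f + g)" "v \<noteq> u" for v
    using that f g by (intro term_less_add) (auto simp: lead_def above_def)
  with sum show ?thesis by (simp add: lead_def in_keys_iff)
qed

lemma lead_monomial_mult:
  assumes "lead w f u" "c \<noteq> 0"
  shows "lead w (Poly_Mapping.single a c * f) (a + u)"
proof -
  have "term_less (tval (Poly_Mapping.single a c * f) w (a + u), a + u)
      (tval (Poly_Mapping.single a c * f) w v, v)"
    if v: "v - a \<in> supp f" "v \<noteq> a + u" for v
  proof -
    have "term_less (tval f w u, u) (tval f w (v - a), v - a)"
      using assms(1) v by (auto simp: lead_def)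
    moreover have "lex_less (a + u) v \<longleftrightarrow> lex_less u (v - a)"
      using lex_less_add_left[of a u "v - a"] by simp
    ultimately show ?thesis
      using tval_monomial_mult[OF assms(2), of u f a w] tval_monomial_mult[OF assms(2) v(1), of a w]
        assms(1) by (auto simp: term_less_def lead_def)
  qed
  then show ?thesis using assms by (simp add: lead_def supp_monomial_mult)
qed

text \<open>Adding this multiple of \<open>g\<close> to \<open>f\<close> clears the exponent
  \<open>p\<close>. If nonzero, it starts with the value of \<open>f\<close> at \<open>p\<close>,
  after the leading term, so by \<open>lead_add\<close> the leading exponent survives.\<close>

lemma above_elimination:
  assumes f: "lead w f u" and g: "lead w g p" "coef g p = 1" and "p \<noteq> u"
  shows "above w (tval f w u, u) (scal (- coef f p) g)"
proof (cases "p \<in> supp f")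
  case True
  then have p: "term_less (tval f w u, u) (tval f w p, p)" "coef f p \<noteq> 0"
    using f assms(4) by (auto simp: lead_def in_keys_iff)
  have "term_less (tval f w u, u) (tval (scal (- coef f p) g) w v, v)" if v: "v \<in> supp g" for v
  proof -
    have "tval f w p = val (- coef f p) + tval g w p"
      using g(2) by (simp add: trop_term_def)
    moreover have "v = p \<or> term_less (tval g w p, p) (tval g w v, v)"
      using g(1) v by (auto simp: lead_def)
    ultimately show ?thesis
      using p v tval_scal[of "- coef f p" v g w]
      by (auto simp: term_less_def intro: lex_less_trans)
  qed
  then show ?thesis using p by (simp add: above_def supp_monomial_mult)
qed (simp add: in_keys_iff)

section \<open>Reduced bases\<close>

definition leads :: "real ^ 'n::finite \<Rightarrow> ('k, 'n) laurent set \<Rightarrow> (int ^ 'n) set" where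
  "leads w L = {u. \<exists>f\<in>L. lead w f u}"

lemma leads_subset: "(\<And>f. f \<in> L \<Longrightarrow> supp f \<subseteq> S) \<Longrightarrow> leads w L \<subseteq> S"
  by (auto simp: leads_def lead_def)

lemma no_leads_imp_zero:
  assumes "f \<in> L" "supp f \<inter> leads w L = {}"
  shows "f = 0"
  using lead_exists[of f w] assms by (auto simp: leads_def lead_def)

text \<open>Gauss-Jordan elimination: a new element is cleared of the old pivots, normalised, and
  then used to clear its own pivot from the old elements. By \<open>above_elimination\<close> no
  leading exponent changes.\<close>

lemma exists_reduced_family:
  assumes L: "coef_space.subspace L" and "finite S" "S \<subseteq> leads w L"
  shows "\<exists>F. \<forall>m\<in>S. F m \<in> L \<and> lead w (F m) m \<and>
      (\<forall>m'\<in>S. coef (F m) m' = (if m' = m then 1 else 0))"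
  using assms(2,3)
proof (induction S rule: finite_induct)
  case (insert p S)
  then obtain F where F: "\<And>m. m \<in> S \<Longrightarrow> F m \<in> L" "\<And>m. m \<in> S \<Longrightarrow> lead w (F m) m"
      "\<And>m m'. m \<in> S \<Longrightarrow> m' \<in> S \<Longrightarrow> coef (F m) m' = (if m' = m then 1 else 0)"
    by fastforce
  obtain g where g: "g \<in> L" "lead w g p" using insert.prems by (auto simp: leads_def)
  define h where "h = g + (\<Sum>m\<in>S. scal (- coef g m) (F m))"
  have h: "h \<in> L" unfolding h_def
    by (intro coef_space.subspace_add[OF L] coef_space.subspace_sum[OF L]
        coef_space.subspace_scale[OF L] g F)
  have lead_h: "lead w h p" unfolding h_def
  proof (intro lead_add g above_sum above_elimination)
    show "lead w (F m) m" "coef (F m) m = 1" "m \<noteq> p" if "m \<in> S" for m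
      using that F insert.hyps by auto
  qed
  have h_S: "coef h m = 0" if "m \<in> S" for m
    using coef_sum_scal_delta[of S m F "\<lambda>m. - coef g m"] insert.hyps F(3) that
    by (simp add: h_def lookup_add)
  define h' where "h' = scal (inverse (coef h p)) h"
  have nz: "coef h p \<noteq> 0" using lead_h by (simp add: lead_def in_keys_iff)
  have h': "h' \<in> L" "lead w h' p" "coef h' p = 1" "\<And>m. m \<in> S \<Longrightarrow> coef h' m = 0"
    using lead_monomial_mult[OF lead_h, of "inverse (coef h p)" 0] nz h_S
      coef_space.subspace_scale[OF L h]
    by (auto simp: h'_def coef_scal)
  define G where "G m = (if m = p then h' else F m + scal (- coef (F m) p) h')" for m
  have "G m \<in> L \<and> lead w (G m) m \<and> (\<forall>m'\<in>insert p S. coef (G m) m' = (if m' = m then 1 else 0))"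
    if m: "m \<in> insert p S" for m
  proof (cases "m = p")
    case True
    then show ?thesis using h' insert.hyps by (auto simp: G_def)
  next
    case False
    with m have mS: "m \<in> S" by simp
    have "lead w (F m + scal (- coef (F m) p) h') m"
      using False by (intro lead_add above_elimination F(2) mS h') auto
    moreover have "F m + scal (- coef (F m) p) h' \<in> L"
      by (intro coef_space.subspace_add[OF L] coef_space.subspace_scale[OF L] F mS h')
    ultimately show ?thesis
      using False mS F(3)[OF mS] h' insert.hyps by (auto simp: G_def lookup_minus coef_scal)
  qed
  then show ?case by blast
qed simp

text \<open>The exponent set \<open>M\<close> replaces the weight, so an element chosen for
  \<open>M\<close> serves every weight with these leading exponents.\<close>

definition reduced :: "('k, 'n::finite) laurent set \<Rightarrow> (int ^ 'n) set \<Rightarrow> int ^ 'n \<Rightarrow> ('k, 'n) laurent \<Rightarrow> bool" where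
  "reduced L M u f \<longleftrightarrow> f \<in> L \<and> coef f u = 1 \<and> supp f \<inter> M = {u}"

lemma exists_reduced:
  assumes "coef_space.subspace L" "finite (leads w L)" "u \<in> leads w L"
  shows "\<exists>f. reduced L (leads w L) u f"
proof -
  from exists_reduced_family[OF assms(1,2) order_refl] assms(3)
  obtain f where "f \<in> L" "\<forall>m'\<in>leads w L. coef f m' = (if m' = u then 1 else 0)" by blast
  then have "reduced L (leads w L) u f"
    using assms(3) by (auto simp: reduced_def in_keys_iff split: if_splits)
  then show ?thesis ..
qed

lemma reduced_coef: "reduced L M u f \<Longrightarrow> q \<in> M \<Longrightarrow> coef f q = (if u = q then 1 else 0)"
  by (auto simp: reduced_def in_keys_iff)

text \<open>The difference lies in \<open>L\<close> and has no exponent in \<open>leads w L\<close>,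
  hence no leading exponent. In particular reduced elements are unique.\<close>

lemma eq_if_coef_eq_on_leads:
  assumes "coef_space.subspace L" "f \<in> L" "g \<in> L" "\<And>q. q \<in> leads w L \<Longrightarrow> coef f q = coef g q"
  shows "f = g"
proof -
  have "f - g = 0"
    using assms(4) coef_space.subspace_diff[OF assms(1-3)]
    by (intro no_leads_imp_zero[of _ L w]) (auto simp: in_keys_iff lookup_minus)
  then show ?thesis by simp
qed

lemma reduced_lead:
  assumes "reduced L (leads w L) u f"
  shows "lead w f u"
proof -
  have "f \<noteq> 0" using assms by (auto simp: reduced_def)
  then obtain v where "lead w f v" using lead_exists by blast
  moreover from this have "v \<in> supp f \<inter> leads w L"
    using assms by (auto simp: reduced_def leads_def lead_def)
  ultimately show ?thesis using assms by (auto simp: reduced_def)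
qed

text \<open>A reduced family taken from \<open>L'\<close> has a combination with the same
  coefficients on \<open>leads w L\<close> as any given \<open>f \<in> L\<close>, and these
  coefficients determine \<open>f\<close>.\<close>

lemma subspace_eq_if_leads_subset:
  assumes L: "coef_space.subspace L" and L': "coef_space.subspace L'" "L' \<subseteq> L"
    and fin: "finite (leads w L)" and "leads w L \<subseteq> leads w L'"
  shows "L' = L"
proof -
  from exists_reduced_family[OF L'(1) fin assms(5)] obtain F where
    F: "\<And>m. m \<in> leads w L \<Longrightarrow> F m \<in> L'" and
    F_coef: "\<And>m m'. m \<in> leads w L \<Longrightarrow> m' \<in> leads w L \<Longrightarrow> coef (F m) m' = (if m = m' then 1 else 0)"
    by fastforce
  have "f \<in> L'" if f: "f \<in> L" for f
  proof -
    have g: "(\<Sum>m\<in>leads w L. scal (coef f m) (F m)) \<in> L'" (is "?g \<in> _")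
      by (intro coef_space.subspace_sum[OF L'(1)] coef_space.subspace_scale[OF L'(1)] F)
    have "f = ?g"
      using g L'(2) fin f
      by (intro eq_if_coef_eq_on_leads[OF L, of _ _ w]) (auto simp: coef_sum_scal_delta F_coef)
    with g show ?thesis by simp
  qed
  with L'(2) show ?thesis by blast
qed

text \<open>For an exponent missing on the left, the reduced element at \<open>w'\<close> would be
  nonzero without an exponent in \<open>leads w L\<close>.\<close>

lemma leads_antichain:
  assumes L: "coef_space.subspace L" and fin: "finite (leads w' L)"
    and sub: "leads w L \<subseteq> leads w' L"
  shows "leads w L = leads w' L"
proof (rule ccontr)
  assume "\<not> ?thesis"
  then obtain u where u: "u \<in> leads w' L" "u \<notin> leads w L" using sub by blast
  obtain f where f: "reduced L (leads w' L) u f" using exists_reduced[OF L fin u(1)] by blast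
  then have "f = 0" using u sub by (intro no_leads_imp_zero[of f L w]) (auto simp: reduced_def)
  with f show False by (simp add: reduced_def)
qed

text \<open>Since \<open>f\<close> is \<open>g\<close> minus the multiples \<open>coef g p\<close>
  of the \<open>r p\<close> with \<open>p \<noteq> u\<close>, a tie of \<open>f\<close> at
  \<open>v\<close> must come from a summand: from a tie of \<open>g\<close> at \<open>v\<close>, or
  from one of \<open>g\<close> at \<open>p\<close> together with one of \<open>r p\<close> at
  \<open>v\<close>. The tie-break makes such a \<open>p\<close> larger than \<open>u\<close>, which
  allows induction.\<close>

lemma reduced_ties:
  assumes L: "coef_space.subspace L" and fin: "finite (leads w L)"
    and g: "g \<in> L" "lead w g u" "coef g u = 1"
    and f: "reduced L (leads w L) u f"
    and r: "\<And>p. p \<in> leads w L \<Longrightarrow> reduced L (leads w L) p (r p)"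
    and v: "v \<in> supp f" "tval f w v = tval f w u"
  shows "v \<in> supp g \<and> tval g w v = tval g w u \<or>
    (\<exists>p\<in>leads w L. p \<in> supp g \<and> tval g w p = tval g w u \<and> lex_less u p \<and>
       v \<in> supp (r p) \<and> tval (r p) w v = tval (r p) w p)"
proof (rule ccontr)
  assume neg: "\<not> ?thesis"
  let ?M = "leads w L"
  define h where "h = (\<Sum>p\<in>?M - {u}. scal (- coef g p) (r p))"
  have u: "u \<in> ?M" using g by (auto simp: leads_def)
  have "coef h u = 0"
    using reduced_coef[OF r u] by (auto simp: h_def lookup_sum coef_scal intro!: sum.neutral)
  moreover have "coef h q = - coef g q" if "q \<in> ?M" "q \<noteq> u" for q
    unfolding h_def using that fin reduced_coef[OF r that(1)] by (intro coef_sum_scal_delta) auto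
  moreover have "h \<in> L"
    unfolding h_def
    by (intro coef_space.subspace_sum[OF L] coef_space.subspace_scale[OF L])
      (use r in \<open>auto simp: reduced_def\<close>)
  ultimately have "f = g + h"
    using g f reduced_coef[OF f] coef_space.subspace_add[OF L]
    by (intro eq_if_coef_eq_on_leads[OF L, of _ _ w]) (auto simp: lookup_add reduced_def)
  then have sum: "coef f v = coef g v + (\<Sum>p\<in>?M - {u}. - coef g p * coef (r p) v)"
    by (simp add: lookup_add h_def lookup_sum coef_scal)
  have W: "val (coef f v) + w \<bullet> (\<chi> i. of_int (v $ i)) = tval g w u"
    using v f g by (simp add: trop_term_def reduced_def)
  have "val_gt (val (coef f v)) (coef g v)"
    using leadD(1)[OF g(2), of v] neg W by (force simp: val_gt_def in_keys_iff trop_term_def)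
  moreover have "val_gt (val (coef f v)) (- coef g p * coef (r p) v)" if p: "p \<in> ?M - {u}" for p
  proof (cases "coef g p = 0 \<or> coef (r p) v = 0")
    case False
    have red: "reduced L ?M p (r p)" using r p by blast
    have "tval g w u \<le> tval g w p" "tval (r p) w p \<le> tval (r p) w v"
      using False leadD(1)[OF g(2), of p] leadD(1)[OF reduced_lead[OF red], of v]
      by (auto simp: in_keys_iff)
    moreover have "tval g w u \<noteq> tval g w p \<or> tval (r p) w p \<noteq> tval (r p) w v"
      using neg p False leadD(2)[OF g(2), of p] by (auto simp: in_keys_iff)
    moreover have "val (coef (r p) p) = 0" using red by (simp add: reduced_def)
    ultimately have "val (coef f v) < val (coef g p) + val (coef (r p) v)"
      using W by (auto simp: trop_term_def)
    then show ?thesis using False val_mult[of "- coef g p" "coef (r p) v"] by (simp add: val_gt_def)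
  qed (auto simp: val_gt_def)
  \<comment> \<open>All summands are zero or have value above that of their sum
    \<open>coef f v\<close>, which is impossible.\<close>
  ultimately have "val_gt (val (coef f v)) (coef f v)"
    unfolding sum[symmetric] by (subst sum) (intro val_gt_add val_gt_sum)
  then show False using v by (simp add: val_gt_def in_keys_iff)
qed

text \<open>Let \<open>f'\<close> be the multiple of \<open>f\<close> with coefficient
  \<open>1\<close> at \<open>u\<close>. A tie of \<open>r\<close> at \<open>v\<close> would survive
  in \<open>r - f'\<close>. The leading exponent of this difference does not occur in
  \<open>r\<close>, so it comes from \<open>f'\<close>, where it lies strictly above the common
  minimum: a contradiction.\<close>

lemma reduced_unique_minimum:
  assumes L: "coef_space.subspace L" and f: "f \<in> L" "u \<in> supp f"
    and min: "\<And>v. v \<in> supp f \<Longrightarrow> v \<noteq> u \<Longrightarrow> tval f w u < tval f w v"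
    and r: "reduced L (leads w L) u r" and v: "v \<in> supp r" "v \<noteq> u"
  shows "tval r w u < tval r w v"
proof (rule ccontr)
  assume "\<not> ?thesis"
  with leadD(1)[OF reduced_lead[OF r] v(1)] have tie: "tval r w v = tval r w u" by simp
  define f' where "f' = scal (inverse (coef f u)) f"
  have nz: "coef f u \<noteq> 0" using f by (simp add: in_keys_iff)
  then have supp_f': "supp f' = supp f"
    by (auto simp: f'_def supp_monomial_mult)
  have f': "f' \<in> L" "coef f' u = 1" 
    using coef_space.subspace_scale[OF L f(1)] nz by (auto simp: f'_def coef_scal)
  have min': "tval f' w u < tval f' w q" if "q \<in> supp f" "q \<noteq> u" for q
    using min[OF that] that f nz by (simp add: f'_def tval_scal)
  have r1: "coef r u = 1" using r by (simp add: reduced_def)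
  then have W: "tval f' w u = tval r w u" using f' by (simp add: trop_term_def)
  define h where "h = r - f'"
  have hL: "h \<in> L" using coef_space.subspace_diff[OF L _ f'(1)] r by (simp add: h_def reduced_def)
  have "val_gt (val (coef r v)) (- coef f' v)"
  proof (cases "v \<in> supp f")
    case True
    then show ?thesis using min'[OF True v(2)] W tie by (simp add: val_gt_def trop_term_def)
  next
    case False
    then show ?thesis by (simp add: val_gt_def in_keys_iff flip: supp_f')
  qed
  from val_add_eq[OF _ this] v(1) have hv: "coef h v \<noteq> 0" "tval h w v = tval r w u"
    using tie by (auto simp: h_def lookup_minus in_keys_iff trop_term_def)
  then obtain q where q: "lead w h q" using lead_exists[of h w] by fastforce
  then have q_supp: "coef h q \<noteq> 0" "q \<in> leads w L" using hL by (auto simp: lead_def leads_def in_keys_iff)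
  have "q \<noteq> u" using q_supp(1) f' r1 by (auto simp: h_def lookup_minus)
  with r q_supp have "coef r q = 0" by (simp add: reduced_coef[OF r])
  then have "coef h q = - coef f' q" by (simp add: h_def lookup_minus)
  with q_supp(1) have "q \<in> supp f" "tval h w q = tval f' w q"
    by (auto simp: trop_term_def in_keys_iff simp flip: supp_f')
  then have "tval r w u < tval h w q" using min' \<open>q \<noteq> u\<close> W by simp
  with leadD(1)[OF q, of v] hv show False by (simp add: in_keys_iff)
qed

text \<open>The minimising exponents of a nonzero \<open>f\<close> form a nonempty set, so having
  fewer than two means being a singleton. For \<open>f = 0\<close> both sides are false.\<close>

lemma notin_trop_hypersurface_iff:
  "w \<notin> trop_hypersurface val f \<longleftrightarrow>
     (\<exists>u\<in>supp f. \<forall>v\<in>supp f. v \<noteq> u \<longrightarrow> tval f w u < tval f w v)"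
proof (cases "f = 0")
  case False
  let ?T = "{u \<in> supp f. tval f w u = trop val f w}"
  have fin: "finite (tval f w ` supp f)" by simp
  have "trop val f w \<in> tval f w ` supp f"
    unfolding trop_def using False by (intro Min_in) auto
  then have ne: "?T \<noteq> {}" by auto
  have le: "trop val f w \<le> tval f w v" if "v \<in> supp f" for v
    unfolding trop_def using that by simp
  have "w \<notin> trop_hypersurface val f \<longleftrightarrow> card ?T = 1"
    using ne False card_gt_0_iff[of ?T] by (auto simp: trop_hypersurface_def)
  also have "\<dots> \<longleftrightarrow> (\<exists>u. ?T = {u})" by (rule card_1_singleton_iff[unfolded One_nat_def[symmetric]])
  also have "\<dots> \<longleftrightarrow> (\<exists>u\<in>supp f. \<forall>v\<in>supp f. v \<noteq> u \<longrightarrow> tval f w u < tval f w v)"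
  proof
    assume "\<exists>u. ?T = {u}"
    then obtain u where u: "?T = {u}" ..
    have "u \<in> supp f" "tval f w u = trop val f w" using u by auto
    moreover have "tval f w v \<noteq> trop val f w" if "v \<in> supp f" "v \<noteq> u" for v
      using u that by auto
    ultimately show "\<exists>u\<in>supp f. \<forall>v\<in>supp f. v \<noteq> u \<longrightarrow> tval f w u < tval f w v"
      using le by (metis order_le_less)
  next
    assume "\<exists>u\<in>supp f. \<forall>v\<in>supp f. v \<noteq> u \<longrightarrow> tval f w u < tval f w v"
    then obtain u where u: "u \<in> supp f" "\<And>v. v \<in> supp f \<Longrightarrow> v \<noteq> u \<Longrightarrow> tval f w u < tval f w v" by blast
    have "v = u" if "v \<in> ?T" for v using u(2)[of v] le[OF u(1)] that by fastforce
    with ne show "\<exists>u. ?T = {u}" by blast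
  qed
  finally show ?thesis .
qed (simp add: trop_hypersurface_def)

end

section \<open>The graded pieces of an ideal\<close>

definition exponent_vec :: "int ^ 'n::finite \<Rightarrow> real ^ 'n" where
  "exponent_vec u = (\<chi> i. of_int (u $ i))"

lemma exponent_vec_add: "exponent_vec (u + v) = exponent_vec u + exponent_vec v"
  by (simp add: exponent_vec_def vec_eq_iff)

locale laurent_ideal = valued_field val
  for val :: "'k::field \<Rightarrow> real" +
  fixes I :: "('k, 'n::finite) laurent set"
  assumes ideal: "is_ideal I"
begin

text \<open>This is the space \<open>J\<^sub>d\<close> of the overview; \<open>initial w\<close> is
  \<open>M w\<close>, and \<open>basis_element (initial w)\<close> is \<open>r\<close>.\<close>

definition piece :: "nat \<Rightarrow> ('k, 'n) laurent set" where
  "piece d = {f \<in> I. supp f \<subseteq> simplex_points d}"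

definition initial :: "real ^ 'n \<Rightarrow> (nat \<times> (int ^ 'n)) set" where
  "initial w = {(d, u). u \<in> leads w (piece d)}"

definition slice :: "(nat \<times> (int ^ 'n)) set \<Rightarrow> nat \<Rightarrow> (int ^ 'n) set" where
  "slice M d = {u. (d, u) \<in> M}"

definition basis_element :: "(nat \<times> (int ^ 'n)) set \<Rightarrow> nat \<times> (int ^ 'n) \<Rightarrow> ('k, 'n) laurent" where
  "basis_element M m = (SOME f. reduced (piece (fst m)) (slice M (fst m)) (snd m) f)"

definition generators :: "(nat \<times> (int ^ 'n)) set \<Rightarrow> (nat \<times> (int ^ 'n)) set" where
  "generators M = (SOME G. finite G \<and> G \<subseteq> M \<and> (\<forall>m\<in>M. \<exists>b\<in>G. graded_le b m))"

text \<open>Only generators are recorded, which keeps the number of possible values finite;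
  \<open>ties_transfer\<close> controls the ties of the other basis elements. Both choices depend on
  \<open>initial w\<close> alone.\<close>

definition ties :: "real ^ 'n \<Rightarrow> ((nat \<times> (int ^ 'n)) \<times> (int ^ 'n)) set" where
  "ties w = (SIGMA m:generators (initial w). {v \<in> supp (basis_element (initial w) m).
     tval (basis_element (initial w) m) w v = tval (basis_element (initial w) m) w (snd m)})"

lemma subspace_piece: "coef_space.subspace (piece d)"
  using ring_module.subspace_0[OF ideal] ring_module.subspace_add[OF ideal]
    ring_module.subspace_scale[OF ideal]
  by (auto simp: coef_space.subspace_def piece_def in_keys_iff coef_scal lookup_add)
    (metis add_0 in_keys_iff subsetD)

lemma leads_piece_subset: "leads w (piece d) \<subseteq> simplex_points d"
  by (rule leads_subset) (simp add: piece_def)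

lemma finite_leads_piece: "finite (leads w (piece d))"
  using finite_subset[OF leads_piece_subset finite_simplex_points] .

lemma slice_initial [simp]: "slice (initial w) d = leads w (piece d)"
  by (simp add: slice_def initial_def)

lemma monomial_mult_piece:
  assumes "f \<in> piece e" "a \<in> simplex_points k"
  shows "Poly_Mapping.single a 1 * f \<in> piece (k + e)"
proof -
  have "v \<in> simplex_points (k + e)" if "v - a \<in> supp f" for v
    using simplex_points_add[OF assms(2), of "v - a" e] assms(1) that by (auto simp: piece_def)
  then show ?thesis
    using assms(1) ring_module.subspace_scale[OF ideal] by (auto simp: piece_def supp_monomial_mult)
qed

section \<open>Up-sets of leading exponents and their finite number\<close>

lemma initial_subset: "initial w \<subseteq> graded_exponents"
  using leads_piece_subset by (auto simp: initial_def graded_exponents_def)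

text \<open>The quotient of the two monomials fits into the remaining degree \<open>d - e\<close>,
  so the product stays in the piece. This makes \<open>initial w\<close> an up-set.\<close>

lemma graded_le_monomial_mult:
  assumes "f \<in> piece e" "lead w f b" "graded_le (e, b) (d, u)"
  shows "Poly_Mapping.single (u - b) 1 * f \<in> piece d"
    and "lead w (Poly_Mapping.single (u - b) 1 * f) u"
proof -
  from assms(3) have "d = (d - e) + e" "u - b \<in> simplex_points (d - e)"
    by (auto simp: graded_le_def)
  then show "Poly_Mapping.single (u - b) 1 * f \<in> piece d"
    using monomial_mult_piece[OF assms(1)] by metis
  show "lead w (Poly_Mapping.single (u - b) 1 * f) u"
    using lead_monomial_mult[OF assms(2), of 1 "u - b"] by simp
qed

lemma initial_upward:
  assumes "m \<in> initial w" "graded_le m m'"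
  shows "m' \<in> initial w"
proof -
  obtain e b d u where m: "m = (e, b)" "m' = (d, u)" by fastforce
  with assms(1) obtain f where "f \<in> piece e" "lead w f b" by (auto simp: initial_def leads_def)
  from graded_le_monomial_mult[OF this, of d u] assms(2) show ?thesis
    by (auto simp: m initial_def leads_def)
qed

lemma basis_element_reduced:
  assumes "(d, u) \<in> initial w"
  shows "reduced (piece d) (leads w (piece d)) u (basis_element (initial w) (d, u))"
proof -
  have "\<exists>f. reduced (piece d) (leads w (piece d)) u f"
    using assms by (intro exists_reduced subspace_piece finite_leads_piece) (simp add: initial_def)
  then show ?thesis unfolding basis_element_def fst_conv snd_conv slice_initial by (rule someI_ex)
qed

lemma basis_element_in_ideal: "m \<in> initial w \<Longrightarrow> basis_element (initial w) m \<in> I"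
  using basis_element_reduced[of "fst m" "snd m" w] by (simp add: reduced_def piece_def)

lemma generators_initial:
  shows finite_generators: "finite (generators (initial w))"
    and generators_subset: "generators (initial w) \<subseteq> initial w"
    and generators_below: "m \<in> initial w \<Longrightarrow> \<exists>b\<in>generators (initial w). graded_le b m"
proof -
  \<comment> \<open>Inserting an element of \<open>initial w\<close> keeps \<open>B\<close> inside
    \<open>initial w\<close>, so maximality puts every such element above one of
    \<open>B\<close>.\<close>
  obtain B where B: "finite B" "B \<subseteq> initial w"
      "\<And>m. m \<in> graded_exponents \<Longrightarrow> insert m B \<subseteq> initial w \<Longrightarrow> \<exists>b\<in>B. graded_le b m"
    using exists_maximal_finite_property[of graded_exponents graded_le "\<lambda>B. B \<subseteq> initial w",
        OF graded_le_wqo]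
    by auto
  have "\<exists>b\<in>B. graded_le b m" if "m \<in> initial w" for m
    using B(2) B(3)[of m] initial_subset[of w] that by auto
  with B(1,2) have "\<exists>B. finite B \<and> B \<subseteq> initial w \<and> (\<forall>m\<in>initial w. \<exists>b\<in>B. graded_le b m)"
    by (intro exI[of _ B]) simp
  then have "finite (generators (initial w)) \<and> generators (initial w) \<subseteq> initial w \<and>
      (\<forall>m\<in>initial w. \<exists>b\<in>generators (initial w). graded_le b m)"
    unfolding generators_def by (rule someI_ex)
  then show "finite (generators (initial w))" "generators (initial w) \<subseteq> initial w"
    "m \<in> initial w \<Longrightarrow> \<exists>b\<in>generators (initial w). graded_le b m"
    by auto
qed

text \<open>
  Call a finite set of exponents big if it lies in infinitely many of the sets \<open>initial w\<close>. The
  up-set of a maximal big set misses, in some fixed degree, an exponent of every \<open>initial w\<close>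
  containing it, since these sets form an antichain in each degree; pigeonhole in that degree
  yields a larger big set.
\<close>

lemma finite_range_initial: "finite (range initial)"
proof (rule ccontr)
  define supersets where "supersets B = {M \<in> range initial. B \<subseteq> M}" for B
  assume "\<not> ?thesis"
  then have "infinite (supersets {})" by (simp add: supersets_def)
  then obtain B where inf: "infinite (supersets B)"
    and max: "\<And>m. m \<in> graded_exponents \<Longrightarrow> infinite (supersets (insert m B)) \<Longrightarrow> \<exists>b\<in>B. graded_le b m"
    using exists_maximal_finite_property[of graded_exponents graded_le "\<lambda>B. infinite (supersets B)",
        OF graded_le_wqo]
    by auto
  define U where "U = {m. \<exists>b\<in>B. graded_le b m}"
  have U: "U \<subseteq> M" if "M \<in> supersets B" for M
    using that initial_upward by (auto simp: U_def supersets_def)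
  have "\<not> supersets B \<subseteq> {U}" using inf finite_subset[of "supersets B" "{U}"] by auto
  then obtain w where "initial w \<in> supersets B" "initial w \<noteq> U" by (auto simp: supersets_def)
  with U have "U \<subset> initial w" by blast
  then obtain d u where M: "(d, u) \<in> initial w" "(d, u) \<notin> U" "U \<subseteq> initial w" by auto
  have "\<exists>v. (d, v) \<notin> U \<and> v \<in> simplex_points d \<and> N \<in> supersets (insert (d, v) B)" if N: "N \<in> supersets B" for N
  proof (rule ccontr)
    assume neg: "\<not> ?thesis"
    obtain w' where w': "N = initial w'" "B \<subseteq> N" using N by (auto simp: supersets_def)
    have "(d, v) \<in> U" if "v \<in> leads w' (piece d)" for v
      using that neg w' leads_piece_subset[of w' d] by (auto simp: supersets_def initial_def)
    moreover from this have "leads w' (piece d) \<subseteq> leads w (piece d)"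
      using M(3) by (auto simp: initial_def)
    then have "leads w' (piece d) = leads w (piece d)"
      by (intro leads_antichain subspace_piece finite_leads_piece)
    ultimately show False using M by (auto simp: initial_def)
  qed
  then have "supersets B \<subseteq> (\<Union>v\<in>{v \<in> simplex_points d. (d, v) \<notin> U}. supersets (insert (d, v) B))" by blast
  with inf have "infinite (\<Union>v\<in>{v \<in> simplex_points d. (d, v) \<notin> U}. supersets (insert (d, v) B))"
    using finite_subset by blast
  moreover have "finite {v \<in> simplex_points d :: (int ^ 'n) set. (d, v) \<notin> U}"
    by (simp add: finite_simplex_points)
  ultimately obtain v where "v \<in> simplex_points d" "(d, v) \<notin> U" "infinite (supersets (insert (d, v) B))"
    by (auto simp: finite_UN)
  then show False using max[of "(d, v)"] by (auto simp: U_def graded_exponents_def)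
qed

lemma finite_range_initial_ties: "finite (range (\<lambda>w. (initial w, ties w)))"
proof (rule finite_subset)
  let ?T = "\<lambda>M. Pow (SIGMA m:generators M. supp (basis_element M m))"
  show "range (\<lambda>w. (initial w, ties w)) \<subseteq> Sigma (range initial) ?T"
    by (auto simp: ties_def)
  have "finite (?T M)" if "M \<in> range initial" for M
    using that finite_generators by auto
  then show "finite (Sigma (range initial) ?T)"
    by (intro finite_SigmaI finite_range_initial)
qed

section \<open>Tropical bases\<close>

lemma tval_exponent_vec: "tval f w u = val (coef f u) + w \<bullet> exponent_vec u"
  by (simp add: trop_term_def exponent_vec_def)

text \<open>Equalities of inner products express that ties persist at \<open>w'\<close> and can be
  chained. A monomial multiple \<open>g\<close> of a generator's basis element leads at
  \<open>u\<close> and has ties known from \<open>ties\<close>; by \<open>reduced_ties\<close>, any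
  other tie passes through a lexicographically larger \<open>p\<close>, where the induction
  hypothesis applies.\<close>

lemma ties_transfer:
  assumes same: "initial w = initial w'" "ties w = ties w'"
    and u: "(d, u) \<in> initial w"
    and v: "v \<in> supp (basis_element (initial w) (d, u))"
      "tval (basis_element (initial w) (d, u)) w v = tval (basis_element (initial w) (d, u)) w u"
  shows "(w' - w) \<bullet> exponent_vec v = (w' - w) \<bullet> exponent_vec u"
proof -
  let ?r = "basis_element (initial w)"
  have "u \<in> simplex_points d" using u leads_piece_subset by (auto simp: initial_def)
  with finite_simplex_points show ?thesis using u v
  proof (induction arbitrary: v rule: lex_less_induct)
    case (1 u)
    obtain e b where b: "(e, b) \<in> generators (initial w)" "graded_le (e, b) (d, u)"
      using generators_below[OF 1(3)] by auto
    then have "(e, b) \<in> initial w" using generators_subset by blast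
    note red_b = basis_element_reduced[OF this] and lead_b = reduced_lead[OF basis_element_reduced[OF this]]
    define g where "g = Poly_Mapping.single (u - b) 1 * ?r (e, b)"
    have g: "g \<in> piece d" "lead w g u" "coef g u = 1"
      using graded_le_monomial_mult[OF _ lead_b b(2)] red_b
      by (auto simp: g_def reduced_def coef_monomial_mult)
    have g_tie: "(w' - w) \<bullet> exponent_vec q = (w' - w) \<bullet> exponent_vec u"
      if q: "q \<in> supp g" "tval g w q = tval g w u" for q
    proof -
      define q' where "q' = q - (u - b)"
      have q_eq: "q = (u - b) + q'" "u = (u - b) + b" by (simp_all add: q'_def)
      have q': "q' \<in> supp (?r (e, b))" using q(1) by (simp add: g_def supp_monomial_mult q'_def)
      have "b \<in> supp (?r (e, b))" using lead_b by (simp add: lead_def)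
      with q' q(2) have tie: "tval (?r (e, b)) w q' = tval (?r (e, b)) w b"
        using tval_monomial_mult[of 1 q' "?r (e, b)" "u - b" w]
          tval_monomial_mult[of 1 b "?r (e, b)" "u - b" w]
        by (simp add: g_def q'_def)
      then have "((e, b), q') \<in> ties w'"
        unfolding same(2)[symmetric] using b(1) q' by (simp add: ties_def)
      then have "tval (?r (e, b)) w' q' = tval (?r (e, b)) w' b"
        using same(1) by (simp add: ties_def)
      with tie have "(w' - w) \<bullet> exponent_vec q' = (w' - w) \<bullet> exponent_vec b"
        by (simp add: tval_exponent_vec inner_diff_left)
      moreover have "exponent_vec q = exponent_vec (u - b) + exponent_vec q'"
        "exponent_vec u = exponent_vec (u - b) + exponent_vec b"
        using exponent_vec_add q_eq by metis+
      ultimately show ?thesis by (simp add: inner_add_right)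
    qed
    have red: "reduced (piece d) (leads w (piece d)) p (?r (d, p))" if "p \<in> leads w (piece d)" for p
      using that by (intro basis_element_reduced) (simp add: initial_def)
    consider "v \<in> supp g" "tval g w v = tval g w u"
      | p where "p \<in> leads w (piece d)" "p \<in> supp g" "tval g w p = tval g w u" "lex_less u p"
          "v \<in> supp (?r (d, p))" "tval (?r (d, p)) w v = tval (?r (d, p)) w p"
      using reduced_ties[OF subspace_piece finite_leads_piece g basis_element_reduced[OF 1(3)] red 1(4,5)]
      by blast
    then show ?case
    proof cases
      case 1
      then show ?thesis by (rule g_tie)
    next
      case 2
      \<comment> \<open>The element \<open>g\<close> links \<open>p\<close> to \<open>u\<close>, and
        the induction hypothesis at \<open>p\<close> links \<open>v\<close> to
        \<open>p\<close>.\<close>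
      then show ?thesis
        using "1.IH"[of p v] leads_piece_subset g_tie[of p] by (auto simp: initial_def)
    qed
  qed
qed

text \<open>A monomial moves an \<open>f\<close> with a unique minimum at \<open>w\<close> into some
  \<open>piece d\<close>, and the basis element of its leading exponent inherits the unique minimum.
  For \<open>w'\<close> in the same class the same exponent leads, and a tie at \<open>w'\<close>
  would transfer back to \<open>w\<close>.\<close>

lemma exists_common_unique_minimum:
  assumes "w \<notin> trop_variety val I"
  shows "\<exists>f\<in>I. \<forall>w'. initial w' = initial w \<longrightarrow> ties w' = ties w \<longrightarrow> w' \<notin> trop_hypersurface val f"
proof -
  obtain f u where f: "f \<in> I" "u \<in> supp f"
      and min: "\<And>v. v \<in> supp f \<Longrightarrow> v \<noteq> u \<Longrightarrow> tval f w u < tval f w v"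
    using assms by (auto simp: trop_variety_def notin_trop_hypersurface_iff)
  obtain a d where a: "\<And>v. v \<in> supp f \<Longrightarrow> a + v \<in> simplex_points d"
    using finite_translate_into_simplex_points[OF finite_keys, of f] by blast
  define g where "g = Poly_Mapping.single a 1 * f"
  have g: "g \<in> piece d" "a + u \<in> supp g"
    using ring_module.subspace_scale[OF ideal f(1)] a f(2)
    by (auto simp: piece_def g_def supp_monomial_mult) (metis add.commute diff_add_cancel)
  have g_min: "tval g w (a + u) < tval g w v" if "v \<in> supp g" "v \<noteq> a + u" for v
  proof -
    have v: "v - a \<in> supp f" "v - a \<noteq> u" using that by (auto simp: g_def supp_monomial_mult)
    then show ?thesis
      using min[OF v] tval_monomial_mult[OF one_neq_zero v(1), of a w]
        tval_monomial_mult[OF one_neq_zero f(2), of a w]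
      by (simp add: g_def)
  qed
  let ?r = "basis_element (initial w) (d, a + u)"
  have "lead w g (a + u)" using g(2) g_min by (simp add: lead_def term_less_def)
  then have in_initial: "(d, a + u) \<in> initial w" using g(1) by (auto simp: initial_def leads_def)
  note red = basis_element_reduced[OF this]
  have r_min: "tval ?r w (a + u) < tval ?r w v" if "v \<in> supp ?r" "v \<noteq> a + u" for v
    using reduced_unique_minimum[OF subspace_piece g g_min red that] .
  have "w' \<notin> trop_hypersurface val ?r" if w': "initial w' = initial w" "ties w' = ties w" for w'
    unfolding notin_trop_hypersurface_iff
  proof (intro bexI[of _ "a + u"] ballI impI)
    have lead': "lead w' ?r (a + u)"
      using reduced_lead[OF basis_element_reduced, of d "a + u" w'] in_initial w' by simp
    then show "a + u \<in> supp ?r" by (simp add: lead_def)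
    fix v
    assume v: "v \<in> supp ?r" "v \<noteq> a + u"
    have "tval ?r w' (a + u) \<noteq> tval ?r w' v"
    proof
      assume tie: "tval ?r w' (a + u) = tval ?r w' v"
      then have "(w - w') \<bullet> exponent_vec v = (w - w') \<bullet> exponent_vec (a + u)"
        using ties_transfer[of w' w d "a + u" v] w' in_initial v by simp
      with tie have "tval ?r w (a + u) = tval ?r w v"
        by (simp add: tval_exponent_vec inner_diff_left)
      with r_min[OF v] show False by simp
    qed
    with leadD(1)[OF lead' v(1)] show "tval ?r w' (a + u) < tval ?r w' v" by simp
  qed
  then show ?thesis using basis_element_in_ideal[OF in_initial] by blast
qed

text \<open>One polynomial is chosen for each of the finitely many classes of weights outside the
  variety.\<close>

lemma exists_finite_witness_set:
  "\<exists>F. finite F \<and> F \<subseteq> I \<and> (\<Inter>f\<in>F. trop_hypersurface val f) \<subseteq> trop_variety val I"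
proof -
  let ?c = "\<lambda>w. (initial w, ties w)"
  have "\<exists>f. f \<in> I \<and> (\<forall>w. ?c w = c \<longrightarrow> w \<notin> trop_hypersurface val f)" if "c \<in> ?c ` (- trop_variety val I)" for c
    using that exists_common_unique_minimum by fastforce
  then obtain p where p: "\<And>c. c \<in> ?c ` (- trop_variety val I) \<Longrightarrow> p c \<in> I"
      "\<And>w. w \<notin> trop_variety val I \<Longrightarrow> w \<notin> trop_hypersurface val (p (?c w))"
    by (metis (no_types, lifting) ComplI image_eqI)
  have "finite (?c ` (- trop_variety val I))"
    using finite_range_initial_ties by (rule rev_finite_subset) auto
  then show ?thesis
    using p by (intro exI[of _ "p ` ?c ` (- trop_variety val I)"]) auto
qed

text \<open>The weight \<open>0\<close> is an arbitrary choice. Monomial multiples of the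
  generators' basis elements reach every leading exponent of each \<open>piece d\<close>, so their
  ideal contains it; every element of \<open>I\<close> is a monomial multiple of an element of some
  piece.\<close>

lemma exists_finite_generating_set:
  "\<exists>F. finite F \<and> F \<subseteq> I \<and> I = ideal_generated_by F"
proof -
  let ?F = "basis_element (initial 0) ` generators (initial 0)"
  have F: "finite ?F" "?F \<subseteq> I"
    using finite_generators generators_subset[of 0] basis_element_in_ideal[of _ 0] by auto
  have mult: "f \<in> ideal_generated_by ?F \<Longrightarrow> c * f \<in> ideal_generated_by ?F" for c f
    by (rule ring_module.span_scale)
  have "piece d \<inter> ideal_generated_by ?F = piece d" for d
  proof (rule subspace_eq_if_leads_subset[OF subspace_piece, of _ _ 0])
    show "coef_space.subspace (piece d \<inter> ideal_generated_by ?F)"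
      by (intro coef_space.subspace_inter subspace_piece)
        (auto simp: coef_space.subspace_def intro: ring_module.span_zero ring_module.span_add mult)
    show "leads 0 (piece d) \<subseteq> leads 0 (piece d \<inter> ideal_generated_by ?F)"
    proof
      fix u
      assume "u \<in> leads 0 (piece d)"
      then have "(d, u) \<in> initial 0" by (simp add: initial_def)
      then obtain e b where b: "(e, b) \<in> generators (initial 0)" "graded_le (e, b) (d, u)"
        using generators_below by fastforce
      then have "(e, b) \<in> initial 0" using generators_subset by blast
      note red = basis_element_reduced[OF this]
      let ?g = "Poly_Mapping.single (u - b) 1 * basis_element (initial 0) (e, b)"
      have "?g \<in> piece d" "lead 0 ?g u"
        using graded_le_monomial_mult[OF _ reduced_lead[OF red] b(2)] red by (auto simp: reduced_def)
      moreover have "?g \<in> ideal_generated_by ?F"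
        using b(1) by (intro mult ring_module.span_base) auto
      ultimately show "u \<in> leads 0 (piece d \<inter> ideal_generated_by ?F)" by (auto simp: leads_def)
    qed
  qed (auto intro: finite_leads_piece)
  then have piece: "piece d \<subseteq> ideal_generated_by ?F" for d by blast
  have "f \<in> ideal_generated_by ?F" if f: "f \<in> I" for f
  proof -
    obtain a d where a: "\<And>v. v \<in> supp f \<Longrightarrow> a + v \<in> simplex_points d"
      using finite_translate_into_simplex_points[OF finite_keys, of f] by blast
    have "Poly_Mapping.single a 1 * f \<in> piece d"
      using ring_module.subspace_scale[OF ideal f] a
      by (auto simp: piece_def supp_monomial_mult) (metis add.commute diff_add_cancel)
    with piece have "Poly_Mapping.single a 1 * f \<in> ideal_generated_by ?F" by blast
    from mult[OF this, of "Poly_Mapping.single (- a) (inverse 1)"] show ?thesis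
      by (simp only: monomial_mult_cancel[OF one_neq_zero])
  qed
  then have "I = ideal_generated_by ?F"
    using ring_module.span_minimal[OF F(2) ideal] by blast
  with F show ?thesis by blast
qed

text \<open>One finite set cuts out the variety and another generates \<open>I\<close>; as both lie
  in \<open>I\<close>, their union does both.\<close>

lemma exists_tropical_basis: "\<exists>F. is_tropical_basis val I F"
proof -
  obtain F G where F: "finite F" "F \<subseteq> I" "(\<Inter>f\<in>F. trop_hypersurface val f) \<subseteq> trop_variety val I"
    and G: "finite G" "G \<subseteq> I" "I = ideal_generated_by G"
    using exists_finite_witness_set exists_finite_generating_set by blast
  have "ideal_generated_by (F \<union> G) = I"
  proof
    show "ideal_generated_by (F \<union> G) \<subseteq> I"
      using F(2) G(2) ideal by (intro ring_module.span_minimal) auto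
    show "I \<subseteq> ideal_generated_by (F \<union> G)"
      by (subst G(3)) (rule ring_module.span_mono, simp)
  qed
  then have "is_tropical_basis val I (F \<union> G)"
    using F G(1,2) by (auto simp: is_tropical_basis_def trop_variety_def)
  then show ?thesis ..
qed

end

theorem theorem2p8:
  fixes val :: "'k::field \<Rightarrow> real"
    and I :: "('k, 'n::finite) laurent set"
  assumes "nontrivial_valuation val"
    and "closure (value_group val) = UNIV"
    and "\<rat> \<subseteq> value_group val"
    and "\<exists>t. is_splitting val t"
    and "is_ideal I"
  shows "\<exists>F. is_tropical_basis val I F"
proof -
  interpret laurent_ideal val I
    using assms(1,5) by unfold_locales (simp_all add: nontrivial_valuation_def)
  show ?thesis by (rule exists_tropical_basis)
qed

end
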